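(* Let $d\ge 1$, let $\delta\in(0,1]$ and let $P\colon\mathfrak{M}(\mathbb{R}^d)\to\{0,1\}$ be a $\delta$-mild property. If $A\subseteq\mathbb{R}^d$ is a Lebesgue measurable set whose upper Banach density $d^*(A)$ is equal to $\delta$, then $A$ has property $P$ at all large scales, i.e. there exists $t_0>0$ such that $P(t^{-1}A)=1$ for all real $t\ge t_0$.
   Context: $m$ denotes $d$-dimensional Lebesgue measure and $Q(x,t)$ denotes the closed cube in $\mathbb{R}^d$ with centre $x$, side length $t$ and sides parallel to the coordinate axes. The upper Banach density of a measurable $A\subseteq\mathbb{R}^d$ is $d^*(A):=\limsup_{t\to\infty}\sup_{x\in\mathbb{R}^d}\frac{m(A\cap Q(x,t))}{m(Q(x,t))}$. $\mathfrak{M}(\mathbb{R}^d)$ is the set of all Lebesgue measurable subsets of $\mathbb{R}^d$; a property is a function $P\colon\mathfrak{M}(\mathbb{R}^d)\to\{0,1\}$, and $A$ has property $P$ if $P(A)=1$. $\mathbb{S}_d$ denotes the set of all $f\in L^\infty(\mathbb{R}^d)$ with $0\le f\le 1$ almost everywhere, equipped with the weak-* topology inherited from $L^\infty(\mathbb{R}^d)\simeq L^1(\mathbb{R}^d)^*$ (compact and metrisable); $\mathbf{1}\in\mathbb{S}_d$ is the constant function $1$. A property $P$ is $\delta$-mild ($\delta\in(0,1]$) if: (1) there is an open set $\mathbb{U}\subseteq\mathbb{S}_d$ such that $\chi_A\in\mathbb{U}$ implies $P(A)=1$; (2) $\delta\mathbf{1}\in\mathbb{U}$; (3) $P(A)=P(A+v)$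 for all $A\in\mathfrak{M}(\mathbb{R}^d)$ and $v\in\mathbb{R}^d$. Here $t^{-1}A=\{t^{-1}a: a\in A\}$. *)

theory Defs
  imports "HOL-Analysis.Analysis" "HOL-Library.Liminf_Limsup"
begin

definition cube :: "'a::euclidean_space \<Rightarrow> real \<Rightarrow> 'a set" where
  "cube x t = cbox (x - (t/2) *\<^sub>R One) (x + (t/2) *\<^sub>R One)"

definition upper_banach_density :: "'a::euclidean_space set \<Rightarrow> ereal" where
  "upper_banach_density A =
     Limsup at_top (\<lambda>t::real. ereal (SUP x. measure lebesgue (A \<inter> cube x t) / measure lebesgue (cube x t)))"

text \<open>S_d: measurable functions with values in [0,1] almost everywhere
  (representatives of elements of L-infinity).\<close>
definition Sd :: "('a::euclidean_space \<Rightarrow> real) set" where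
  "Sd = {f. f \<in> borel_measurable lebesgue \<and> (AE x in lebesgue. 0 \<le> f x \<and> f x \<le> 1)}"

text \<open>Open subsets of S_d for the weak-* topology induced by L-infinity = (L^1)*:
  basic neighbourhoods of f are given by finitely many L^1 functions g and e > 0.\<close>
definition weakstar_open_Sd :: "('a::euclidean_space \<Rightarrow> real) set \<Rightarrow> bool" where
  "weakstar_open_Sd U \<longleftrightarrow> U \<subseteq> Sd \<and>
     (\<forall>f\<in>U. \<exists>G e. finite G \<and> (\<forall>g\<in>G. integrable lebesgue g) \<and> e > 0 \<and>
        (\<forall>h\<in>Sd. (\<forall>g\<in>G. \<bar>integral\<^sup>L lebesgue (\<lambda>x. (h x - f x) * g x)\<bar> < e) \<longrightarrow> h \<in> U))"

text \<open>delta-mild property (only its values on measurable sets matter).\<close>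
definition mild :: "real \<Rightarrow> ('a::euclidean_space set \<Rightarrow> bool) \<Rightarrow> bool" where
  "mild \<delta> P \<longleftrightarrow>
     (\<exists>U. weakstar_open_Sd U \<and> (\<lambda>_. \<delta>) \<in> U \<and>
          (\<forall>A\<in>sets lebesgue. (indicator A :: 'a \<Rightarrow> real) \<in> U \<longrightarrow> P A)) \<and>
     (\<forall>A\<in>sets lebesgue. \<forall>v. P A = P ((\<lambda>a. v + a) ` A))"

end

(* By averaging, A has cubes of density close to \<delta> at every side length, while at all large
   side lengths no cube has density much above \<delta>. Hence, for large t, a translate B of
   A/t has density at least \<delta> - c in a fixed large cube Q and at most \<delta> + c in every
   cube of side at least c. Covering a set S inside Q by finitely many cubes up to small measure
   bounds m(B \<inter> S) above by about \<delta> m(S); applying this to Q - S as well gives the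
   lower bound. Approximating L^1 functions by simple functions, the indicator of B is weak-*
   close to the constant \<delta>. *)

theory Submission
  imports Defs
begin

section \<open>Cubes and their images under scaling and translation\<close>

lemma lmeasurable_cube [simp]: "cube x s \<in> lmeasurable"
  and sets_lebesgue_cube [simp]: "cube x s \<in> sets lebesgue"
  by (simp_all add: cube_def)

lemma mem_cube:
  "y \<in> cube x s \<longleftrightarrow> (\<forall>i\<in>Basis. x \<bullet> i - s/2 \<le> y \<bullet> i \<and> y \<bullet> i \<le> x \<bullet> i + s/2)"
  by (simp add: cube_def mem_box inner_diff_left inner_add_left)

lemma measure_cube:
  fixes x :: "'a::euclidean_space"
  assumes "0 \<le> s"
  shows "measure lebesgue (cube x s) = s ^ DIM('a)"
  using assms by (simp add: cube_def, subst content_cbox) (auto simp: algebra_simps)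

lemma measure_cube_pos: "0 < s \<Longrightarrow> 0 < measure lebesgue (cube x s)"
  by (simp add: measure_cube)

text \<open>Scalings and translations carry axis-parallel cubes to axis-parallel cubes, so the
  preimage of \<open>cube y s\<close> is again a cube. The two maps are merged into one so that
  \<open>measure_lebesgue_affine\<close> applies.\<close>

lemma affine_image_Int_cube:
  fixes A :: "'a::euclidean_space set"
  assumes "0 < t"
  shows "(\<lambda>a. v + a) ` (\<lambda>a. inverse t *\<^sub>R a) ` A \<inter> cube y s
    = (\<lambda>a. inverse t *\<^sub>R a + v) ` (A \<inter> cube (t *\<^sub>R (y - v)) (t * s))"
proof -
  have "inverse t *\<^sub>R a + v \<in> cube y s \<longleftrightarrow> a \<in> cube (t *\<^sub>R (y - v)) (t * s)" for a
    using assms unfolding mem_cube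
    by (intro ball_cong refl) (auto simp: inner_add_left inner_diff_left field_simps)
  then show ?thesis
    by (auto simp: image_image add.commute)
qed

lemma affine_image_lebesgue:
  fixes A :: "'a::euclidean_space set"
  assumes "A \<in> sets lebesgue"
  shows "(\<lambda>a. v + a) ` (\<lambda>a. r *\<^sub>R a) ` A \<in> sets lebesgue"
  using assms
  by (intro lebesgue_sets_translation differentiable_image_in_sets_lebesgue derivative_intros) auto

lemma measure_affine_image_Int_cube:
  fixes A :: "'a::euclidean_space set"
  assumes "0 < t"
  shows "measure lebesgue ((\<lambda>a. v + a) ` (\<lambda>a. inverse t *\<^sub>R a) ` A \<inter> cube y s)
    = measure lebesgue (A \<inter> cube (t *\<^sub>R (y - v)) (t * s)) / t ^ DIM('a)"
  unfolding affine_image_Int_cube[OF assms] using assms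
  by (subst measure_lebesgue_affine) (simp add: field_simps)

section \<open>Densities of a set in large cubes\<close>

text \<open>The supremum in \<open>upper_banach_density\<close> is one of reals, to which
  \<open>cSUP_upper\<close> applies only for a bounded family; this is the bound.\<close>

lemma density_cube_le_1:
  fixes A :: "'a::euclidean_space set"
  assumes "A \<in> sets lebesgue"
  shows "measure lebesgue (A \<inter> cube x t) / measure lebesgue (cube x t) \<le> 1"
proof -
  have "measure lebesgue (A \<inter> cube x t) \<le> measure lebesgue (cube x t)"
    using assms by (intro measure_mono_fmeasurable) auto
  \<comment> \<open>A null cube, such as one with \<open>t \<le> 0\<close>, gives the quotient
    \<open>0\<close> by the convention for division by zero.\<close>
  then show ?thesis
    by (auto simp: divide_le_eq_1 zero_less_measure_iff)
qed

lemma eventually_density_le: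
  fixes A :: "'a::euclidean_space set"
  assumes A: "A \<in> sets lebesgue" and "upper_banach_density A < ereal c"
  shows "\<exists>t1>0. \<forall>s\<ge>t1. \<forall>x. measure lebesgue (A \<inter> cube x s) \<le> c * measure lebesgue (cube x s)"
proof -
  let ?d = "\<lambda>x t. measure lebesgue (A \<inter> cube x t) / measure lebesgue (cube x t)"
  have "\<forall>\<^sub>F t in at_top. ereal (SUP x. ?d x t) < ereal c"
    using assms(2) unfolding upper_banach_density_def by (rule Limsup_lessD)
  then obtain t1 where t1: "\<And>t. t \<ge> t1 \<Longrightarrow> (SUP x. ?d x t) < c"
    by (auto simp: eventually_at_top_linorder)
  \<comment> \<open>The \<open>1\<close> keeps the side length positive, so that the quotient can be
    multiplied out, and makes the threshold positive.\<close>
  have "measure lebesgue (A \<inter> cube x s) \<le> c * measure lebesgue (cube x s)"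
    if "s \<ge> max 1 t1" for x s
  proof -
    have "bdd_above (range (\<lambda>x. ?d x s))"
      using density_cube_le_1[OF A] by (intro bdd_aboveI[of _ 1]) auto
    then have "?d x s \<le> (SUP x. ?d x s)"
      by (intro cSUP_upper) auto
    with t1[of s] that have "?d x s \<le> c" by force
    with that show ?thesis
      using measure_cube_pos[of s x] by (simp add: field_simps)
  qed
  then show ?thesis
    by (intro exI[of _ "max 1 t1"]) auto
qed

text \<open>A grid of cells of side \<open>s\<close> is laid out from the lower corner of
  \<open>cube x T\<close>. The explicit count matters: it makes the total volume of the cells
  asymptotic to that of the large cube as \<open>T\<close> grows.\<close>

lemma cube_subset_UN_cubes:
  fixes x :: "'a::euclidean_space"
  assumes "0 < s" "0 \<le> T"
  obtains C where "finite C" "card C \<le> (nat \<lfloor>T / s\<rfloor> + 1) ^ DIM('a)"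
    "cube x T \<subseteq> (\<Union>y\<in>C. cube y s)"
proof
  define N where "N = nat \<lfloor>T / s\<rfloor>"
  \<comment> \<open>Along \<open>i\<close> the large cube starts at
    \<open>x \<bullet> i - T/2\<close>; adding \<open>s * real (k i)\<close> reaches the lower end
    of cell \<open>k\<close>, and a further \<open>s/2\<close> its centre.\<close>
  define ctr where "ctr k = x + (\<Sum>i\<in>Basis. (s * real (k i) + s/2 - T/2) *\<^sub>R i)" for k
  define C where "C = ctr ` (Basis \<rightarrow>\<^sub>E {..N})"
  show "finite C"
    unfolding C_def by (intro finite_imageI finite_PiE) auto
  have "card C \<le> card ((Basis::'a set) \<rightarrow>\<^sub>E {..N})"
    unfolding C_def by (intro card_image_le finite_PiE) auto
  then show "card C \<le> (nat \<lfloor>T / s\<rfloor> + 1) ^ DIM('a)"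
    by (simp add: card_PiE N_def)
  show "cube x T \<subseteq> (\<Union>y\<in>C. cube y s)"
  proof
    fix z assume z: "z \<in> cube x T"
    \<comment> \<open>Rounding down the offset of \<open>z\<close> from the lower corner finds its
      cell. If \<open>T / s\<close> is an integer, points on an upper face get the index
      \<open>N\<close>, so \<open>N\<close> itself must be allowed. The restricted lambda makes
      \<open>k\<close> extensional, as membership in \<open>\<rightarrow>\<^sub>E\<close>
      demands.\<close>
    define k where "k = (\<lambda>i\<in>Basis. nat \<lfloor>(z \<bullet> i - x \<bullet> i + T/2) / s\<rfloor>)"
    have k: "k i \<le> N \<and> s * real (k i) \<le> z \<bullet> i - x \<bullet> i + T/2
        \<and> z \<bullet> i - x \<bullet> i + T/2 \<le> s * real (k i) + s" if "i \<in> Basis" for i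
    proof -
      let ?w = "z \<bullet> i - x \<bullet> i + T/2"
      have w: "0 \<le> ?w" "?w \<le> T"
        using z that by (auto simp: mem_cube algebra_simps)
      have "\<lfloor>?w / s\<rfloor> \<le> \<lfloor>T / s\<rfloor>"
        using w assms by (intro floor_mono divide_right_mono) auto
      then have "k i \<le> N"
        using that by (auto simp: k_def N_def intro: nat_mono)
      moreover have eq: "real (k i) = of_int \<lfloor>?w / s\<rfloor>"
        using that w assms by (simp add: k_def)
      have "of_int \<lfloor>?w / s\<rfloor> \<le> ?w / s" "?w / s \<le> of_int \<lfloor>?w / s\<rfloor> + 1"
        by linarith+
      then have "real (k i) * s \<le> ?w" "?w \<le> (real (k i) + 1) * s"
        unfolding eq using assms by (simp_all only: pos_le_divide_eq pos_divide_le_eq)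
      ultimately show ?thesis
        by (simp add: algebra_simps)
    qed
    have "k \<in> extensional Basis"
      by (simp add: k_def)
    with k have "ctr k \<in> C"
      by (auto simp: C_def PiE_iff)
    moreover have "z \<in> cube (ctr k) s"
      unfolding mem_cube
    proof
      fix i :: 'a assume i: "i \<in> Basis"
      have "ctr k \<bullet> i = x \<bullet> i + (s * real (k i) + s/2 - T/2)"
        using i by (simp add: ctr_def inner_add_left)
      then show "ctr k \<bullet> i - s/2 \<le> z \<bullet> i \<and> z \<bullet> i \<le> ctr k \<bullet> i + s/2"
        using k[OF i] by linarith
    qed
    ultimately show "z \<in> (\<Union>y\<in>C. cube y s)" by blast
  qed
qed

text \<open>Sum the hypothesis over the grid cells: their total volume is at most
  \<open>(T + s) ^ DIM('a)\<close>, because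
  \<open>(\<lfloor>T / s\<rfloor> + 1) * s \<le> T + s\<close>.\<close>

lemma measure_Int_cube_le_of_small_cubes:
  fixes A :: "'a::euclidean_space set"
  assumes A: "A \<in> sets lebesgue" and "0 < s" "0 \<le> T" "0 \<le> c"
    and le: "\<And>y. measure lebesgue (A \<inter> cube y s) \<le> c * measure lebesgue (cube y s)"
  shows "measure lebesgue (A \<inter> cube x T) \<le> c * (T + s) ^ DIM('a)"
proof -
  obtain C where C: "finite C" "card C \<le> (nat \<lfloor>T / s\<rfloor> + 1) ^ DIM('a)"
    "cube x T \<subseteq> (\<Union>y\<in>C. cube y s)"
    using cube_subset_UN_cubes[OF \<open>0 < s\<close> \<open>0 \<le> T\<close>] by blast
  have lm: "A \<inter> cube y s \<in> lmeasurable" for y s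
    using A by (intro fmeasurable_Int_fmeasurable[OF lmeasurable_cube, of A, unfolded Int_commute[of _ A]]) 
  have "measure lebesgue (A \<inter> cube x T) \<le> measure lebesgue (\<Union>y\<in>C. A \<inter> cube y s)"
    using C A by (intro measure_mono_fmeasurable fmeasurable.finite_UN) (auto simp: lm)
  also have "\<dots> \<le> (\<Sum>y\<in>C. measure lebesgue (A \<inter> cube y s))"
    using C lm by (intro measure_UNION_le) (auto simp: fmeasurableD)
  also have "\<dots> \<le> (\<Sum>y\<in>C. c * s ^ DIM('a))"
    using le \<open>0 < s\<close> by (intro sum_mono) (simp add: measure_cube)
  also have "\<dots> = real (card C) * (c * s ^ DIM('a))" by simp
  also have "\<dots> \<le> (of_int \<lfloor>T / s\<rfloor> + 1) ^ DIM('a) * (c * s ^ DIM('a))"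
  proof -
    have "real (card C) \<le> real ((nat \<lfloor>T / s\<rfloor> + 1) ^ DIM('a))"
      using C(2) of_nat_le_iff by blast
    then show ?thesis
      using assms by (intro mult_right_mono) (auto simp: add.commute)
  qed
  also have "\<dots> = c * ((of_int \<lfloor>T / s\<rfloor> + 1) * s) ^ DIM('a)"
    by (simp add: power_mult_distrib)
  also have "\<dots> \<le> c * (T + s) ^ DIM('a)"
  proof -
    have "of_int \<lfloor>T / s\<rfloor> \<le> T / s" by linarith
    then have "of_int \<lfloor>T / s\<rfloor> * s \<le> T"
      using \<open>0 < s\<close> by (simp only: pos_le_divide_eq)
    moreover have "0 \<le> of_int \<lfloor>T / s\<rfloor> * s"
      using assms by simp
    ultimately show ?thesis
      using assms by (intro mult_left_mono power_mono) (auto simp: algebra_simps)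
  qed
  finally show ?thesis .
qed

text \<open>Averaging: if all cubes of side \<open>s\<close> had density below \<open>c\<close>, the
  grid cover would bound the density in every cube of side \<open>T\<close> by
  \<open>c * ((T + s) / T) ^ DIM('a)\<close>. This tends to \<open>c\<close>, so the upper Banach
  density would be at most \<open>c\<close>.\<close>

lemma exists_dense_cube:
  fixes A :: "'a::euclidean_space set"
  assumes A: "A \<in> sets lebesgue" and "0 < s" and c: "ereal c < upper_banach_density A"
  shows "\<exists>x. c * measure lebesgue (cube x s) \<le> measure lebesgue (A \<inter> cube x s)"
proof (rule ccontr)
  assume "\<not> ?thesis"
  then have lt: "measure lebesgue (A \<inter> cube x s) < c * measure lebesgue (cube x s)" for x
    by (simp add: not_le)
  \<comment> \<open>The sign of \<open>c\<close> is not given; the contrary assumption forces it to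
    be nonnegative, as the covering bound demands.\<close>
  have "0 \<le> measure lebesgue (A \<inter> cube 0 s)" by simp
  also have "\<dots> < c * measure lebesgue (cube (0::'a) s)" by (rule lt)
  finally have "0 \<le> c"
    using measure_cube_pos[OF \<open>0 < s\<close>, of "0::'a"] by (simp add: zero_less_mult_iff)
  let ?d = "\<lambda>x t. measure lebesgue (A \<inter> cube x t) / measure lebesgue (cube x t)"
  have "(SUP x. ?d x T) \<le> c * ((T + s) / T) ^ DIM('a)" if "T > 0" for T
  proof (intro cSUP_least)
    fix x
    show "?d x T \<le> c * ((T + s) / T) ^ DIM('a)"
      using measure_Int_cube_le_of_small_cubes[OF A \<open>0 < s\<close> _ \<open>0 \<le> c\<close> less_imp_le[OF lt], of T x] that
      by (simp add: measure_cube power_divide divide_right_mono)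
  qed simp
  then have "\<forall>\<^sub>F T in at_top. ereal (SUP x. ?d x T) \<le> ereal (c * ((T + s) / T) ^ DIM('a))"
    by (intro eventually_mono[OF eventually_gt_at_top[of 0]]) simp
  then have "upper_banach_density A \<le> Limsup at_top (\<lambda>T. ereal (c * ((T + s) / T) ^ DIM('a)))"
    unfolding upper_banach_density_def by (rule Limsup_mono)
  also have "\<dots> = ereal c"
  proof (intro lim_imp_Limsup)
    have "((\<lambda>T::real. 1 + s / T) \<longlongrightarrow> 1 + 0) at_top"
      by (intro tendsto_intros tendsto_divide_0[OF tendsto_const]
          filterlim_at_top_imp_at_infinity filterlim_ident)
    moreover have "\<forall>\<^sub>F T::real in at_top. 1 + s / T = (T + s) / T"
      using eventually_gt_at_top[of 0] by eventually_elim (simp add: field_simps)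
    ultimately have "((\<lambda>T::real. (T + s) / T) \<longlongrightarrow> 1) at_top"
      by (simp add: tendsto_cong)
    then have "((\<lambda>T::real. c * ((T + s) / T) ^ DIM('a)) \<longlongrightarrow> c * 1 ^ DIM('a)) at_top"
      by (intro tendsto_intros)
    then show "((\<lambda>T::real. ereal (c * ((T + s) / T) ^ DIM('a))) \<longlongrightarrow> ereal c) at_top"
      by simp
  qed simp
  finally show False using c by simp
qed


section \<open>Upper bounds: from cubes to bounded measurable sets\<close>

text \<open>One parameter \<open>c\<close> serves both as the least admissible side length and as
  the excess density, so that a single limit \<open>c \<rightarrow> 0\<close> from the right
  controls both.\<close>

definition cubewise_le :: "real \<Rightarrow> real \<Rightarrow> 'a::euclidean_space set \<Rightarrow> bool" where
  "cubewise_le \<delta> c B \<longleftrightarrow> B \<in> sets lebesgue \<and>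
     (\<forall>x. \<forall>s\<ge>c. measure lebesgue (B \<inter> cube x s) \<le> (\<delta> + c) * measure lebesgue (cube x s))"

text \<open>A countable dyadic cover of nearly minimal measure is cut down to a finite subfamily
  \<open>F\<close>. The full union is kept as \<open>U\<close>, since \<open>F\<close> alone may
  miss part of \<open>S\<close>; what is missed lies in the small set
  \<open>U - \<Union>F\<close>.\<close>

lemma finite_cubes_approx:
  fixes S :: "'a::euclidean_space set"
  assumes S: "S \<in> lmeasurable" "S \<subseteq> cube 0 n" and "0 < n" "0 < e"
  obtains F U where "finite F" "\<And>K. K \<in> F \<Longrightarrow> \<exists>x s. 0 < s \<and> K = cube x s"
    "U \<in> lmeasurable" "S \<subseteq> U" "\<Union>F \<subseteq> U"
    "(\<Sum>K\<in>F. measure lebesgue K) \<le> measure lebesgue S + e"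
    "measure lebesgue (U - \<Union>F) \<le> e"
proof -
  define a b where "a = - (n/2) *\<^sub>R (One::'a)" and "b = (n/2) *\<^sub>R (One::'a)"
  have box: "box a b \<noteq> {}"
    using \<open>0 < n\<close> by (simp add: box_ne_empty a_def b_def)
  have "S \<subseteq> cbox a b"
    using S(2) by (simp add: cube_def a_def b_def)
  then obtain \<D> where \<D>: "countable \<D>"
        "\<And>K. K \<in> \<D> \<Longrightarrow> K \<subseteq> cbox a b \<and> K \<noteq> {} \<and> (\<exists>c d. K = cbox c d)"
        "pairwise (\<lambda>A B. interior A \<inter> interior B = {}) \<D>"
        "\<And>u v. cbox u v \<in> \<D> \<Longrightarrow> \<exists>n. \<forall>i \<in> Basis. v \<bullet> i - u \<bullet> i = (b \<bullet> i - a \<bullet> i)/2^n"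
        "S \<subseteq> \<Union>\<D>" "\<Union>\<D> \<in> lmeasurable" "measure lebesgue (\<Union>\<D>) \<le> measure lebesgue S + e"
    using measurable_outer_intervals_bounded[OF S(1) _ \<open>0 < e\<close>, of a b] by metis
  \<comment> \<open>The bounding box is itself a cube of side \<open>n\<close>, so its dyadic pieces
    have equal sides \<open>n / 2^k\<close>; the centre is the midpoint of the two corners.\<close>
  have cubes: "\<exists>x s. 0 < s \<and> K = cube x s" if KD: "K \<in> \<D>" for K
  proof -
    obtain u v where K: "K = cbox u v" using \<D>(2)[OF KD] by blast
    then obtain k where k: "\<And>i. i \<in> Basis \<Longrightarrow> v \<bullet> i - u \<bullet> i = (b \<bullet> i - a \<bullet> i)/2^k"
      using \<D>(4) KD by blast
    define s where "s = n / 2^k"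
    have vu: "v \<bullet> i - u \<bullet> i = s" if "i \<in> Basis" for i
      using k[OF that] that by (simp add: a_def b_def s_def)
    have "K = cube ((1/2) *\<^sub>R (u + v)) s"
      unfolding K using vu
      by (intro set_eqI) (auto simp: mem_box mem_cube inner_add_left algebra_simps add_divide_distrib)
    moreover have "0 < s" using \<open>0 < n\<close> by (simp add: s_def)
    ultimately show ?thesis by blast
  qed
  have meas: "K \<in> lmeasurable" if "K \<in> \<D>" for K
    using cubes[OF that] by auto
  \<comment> \<open>Continuity from below along the finite initial parts of an enumeration gives
    \<open>F\<close>. The empty family is treated apart because \<open>from_nat_into\<close>
    enumerates only nonempty sets.\<close>
  have "\<exists>F. finite F \<and> F \<subseteq> \<D> \<and> measure lebesgue (\<Union>\<D>) - e \<le> measure lebesgue (\<Union>F)"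
  proof (cases "\<D> = {}")
    case True
    then show ?thesis using \<open>0 < e\<close> by (intro exI[of _ "{}"]) auto
  next
    case False
    let ?U = "\<lambda>k. \<Union>(from_nat_into \<D> ` {..k::nat})"
    have UN: "(\<Union>k. ?U k) = \<Union>\<D>"
    proof -
      have "(\<Union>k. ?U k) = \<Union>(range (from_nat_into \<D>))" by blast
      then show ?thesis by (simp only: range_from_nat_into[OF False \<D>(1)])
    qed
    have sub: "from_nat_into \<D> ` {..k} \<subseteq> \<D>" for k
      using from_nat_into[OF False] by (rule image_subsetI)
    have "(\<lambda>k. measure lebesgue (?U k)) \<longlonglongrightarrow> measure lebesgue (\<Union>k. ?U k)"
    proof (rule Lim_measure_incseq)
      show "range ?U \<subseteq> sets lebesgue"
        using sub meas by (intro image_subsetI sets.finite_Union) (auto simp: fmeasurableD)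
      show "incseq ?U" by (intro monoI) force
      show "emeasure lebesgue (\<Union>k. ?U k) \<noteq> \<infinity>"
        unfolding UN using fmeasurableD2[OF \<D>(6)] by simp
    qed
    then have "\<forall>\<^sub>F k in sequentially. measure lebesgue (\<Union>\<D>) - e < measure lebesgue (?U k)"
      unfolding UN using \<open>0 < e\<close> by (intro order_tendstoD(1)) auto
    from eventually_happens'[OF trivial_limit_sequentially this]
    obtain k where "measure lebesgue (\<Union>\<D>) - e < measure lebesgue (?U k)" ..
    then show ?thesis using sub[of k] by (intro exI[of _ "from_nat_into \<D> ` {..k}"]) auto
  qed
  then obtain F where F: "finite F" "F \<subseteq> \<D>"
      "measure lebesgue (\<Union>\<D>) - e \<le> measure lebesgue (\<Union>F)" by blast
  have mF: "\<Union>F \<in> lmeasurable"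
    using F meas by (intro fmeasurable.finite_Union) auto
  \<comment> \<open>Distinct cubes have disjoint interiors, so they meet only in their frontiers,
    which are null sets by convexity.\<close>
  have "(\<Sum>K\<in>F. measure lebesgue K) = measure lebesgue (\<Union>F)"
  proof (rule measure_negligible_finite_Union[symmetric, OF F(1)])
    have "negligible (K \<inter> L)" if KL: "K \<in> F" "L \<in> F" "K \<noteq> L" for K L
    proof -
      have "interior K \<inter> interior L = {}"
        using \<D>(3) F(2) KL by (auto simp: pairwise_def)
      moreover obtain x s y t where "K = cube x s" "L = cube y t"
        using cubes F(2) KL by (metis subsetD)
      ultimately have "K \<inter> L \<subseteq> frontier K \<union> frontier L"
        by (auto simp: frontier_def cube_def closure_closed)
      moreover have "negligible (frontier K \<union> frontier L)"
        by (simp add: \<open>K = _\<close> \<open>L = _\<close> cube_def negligible_convex_frontier)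
      ultimately show ?thesis by (rule negligible_subset[rotated])
    qed
    then show "pairwise (\<lambda>S T. negligible (S \<inter> T)) F" by (auto simp: pairwise_def)
  qed (use meas F in auto)
  moreover have "measure lebesgue (\<Union>F) \<le> measure lebesgue (\<Union>\<D>)"
    using F \<D>(6) mF by (intro measure_mono_fmeasurable) auto
  moreover have "measure lebesgue (\<Union>\<D> - \<Union>F) = measure lebesgue (\<Union>\<D>) - measure lebesgue (\<Union>F)"
    using F \<D>(6) mF by (intro measurable_measure_Diff) (auto simp: fmeasurableD)
  ultimately show thesis
    using F \<D>(5-7) cubes by (intro that[of F "\<Union>\<D>"]) auto
qed

text \<open>The finite family of cubes is chosen before \<open>c\<close>. Once \<open>c\<close> is
  below all their sides, \<open>cubewise_le\<close> applies to each of them, uniformly in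
  \<open>B\<close>, while the uncovered rest contributes at most its own measure.\<close>

lemma eventually_cubewise_le_Int:
  fixes S :: "'a::euclidean_space set"
  assumes S: "S \<in> lmeasurable" "S \<subseteq> cube 0 n" and "0 < n" "0 \<le> \<delta>" "0 < e"
  shows "\<forall>\<^sub>F c in at_right 0. \<forall>B. cubewise_le \<delta> c B \<longrightarrow>
           measure lebesgue (B \<inter> S) \<le> \<delta> * measure lebesgue S + e"
proof -
  \<comment> \<open>As \<open>c \<rightarrow> 0\<close> the total error tends to
    \<open>(\<delta> + 1) * r = e / 2\<close>, which leaves slack for small positive
    \<open>c\<close>.\<close>
  define r where "r = e / (2 * (\<delta> + 1))"
  have "0 < r" using assms by (simp add: r_def)
  obtain F U where F: "finite F" "\<And>K. K \<in> F \<Longrightarrow> \<exists>x s. 0 < s \<and> K = cube x s"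
    and U: "U \<in> lmeasurable" "S \<subseteq> U" "\<Union>F \<subseteq> U"
    and sum: "(\<Sum>K\<in>F. measure lebesgue K) \<le> measure lebesgue S + r"
    and diff: "measure lebesgue (U - \<Union>F) \<le> r"
    using finite_cubes_approx[OF S \<open>0 < n\<close> \<open>0 < r\<close>] by metis
  have "\<forall>\<^sub>F c in at_right 0. \<forall>K\<in>F. \<exists>x s. c \<le> s \<and> K = cube x s"
  proof (intro eventually_ball_finite \<open>finite F\<close> ballI)
    fix K assume "K \<in> F"
    then obtain x s where K: "0 < s" "K = cube x s" using F by blast
    then show "\<forall>\<^sub>F c in at_right 0. \<exists>x s. c \<le> s \<and> K = cube x s"
      by (auto simp: eventually_at_right_field intro!: exI[of _ s] exI[of _ x])
  qed
  moreover have "\<forall>\<^sub>F c in at_right 0. (\<delta> + c) * (measure lebesgue S + r) + r < \<delta> * measure lebesgue S + e"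
  proof (rule order_tendstoD(2))
    show "((\<lambda>c. (\<delta> + c) * (measure lebesgue S + r) + r) \<longlongrightarrow>
        (\<delta> + 0) * (measure lebesgue S + r) + r) (at_right 0)"
      by (intro tendsto_intros)
    have "(\<delta> + 1) * r = e / 2" using assms by (simp add: r_def field_simps)
    then have "(\<delta> + 1) * r < e" using assms by simp
    then show "(\<delta> + 0) * (measure lebesgue S + r) + r < \<delta> * measure lebesgue S + e"
      by (simp add: algebra_simps)
  qed
  ultimately show ?thesis
    using eventually_at_right_less[of 0]
  proof eventually_elim
    case (elim c)
    show ?case
    proof (intro allI impI)
      fix B :: "'a set" assume "cubewise_le \<delta> c B"
      then have B: "B \<in> sets lebesgue"
        "\<And>x s. c \<le> s \<Longrightarrow> measure lebesgue (B \<inter> cube x s) \<le> (\<delta> + c) * measure lebesgue (cube x s)"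
        by (auto simp: cubewise_le_def)
      have K: "K \<in> lmeasurable" if "K \<in> F" for K
        using F(2)[OF that] by auto
      have mK: "B \<inter> K \<in> lmeasurable" if "K \<in> F" for K
        using K[OF that] B(1) by (metis Int_commute fmeasurable_Int_fmeasurable)
      have mF: "\<Union>F \<in> lmeasurable"
        using F K by (intro fmeasurable.finite_Union) auto
      have mD: "U - \<Union>F \<in> lmeasurable"
        using U mF by (intro fmeasurable_Diff) (auto simp: fmeasurableD)
      have mBF: "(\<Union>K\<in>F. B \<inter> K) \<in> lmeasurable"
        using F mK by (intro fmeasurable.finite_UN) auto
      have "measure lebesgue (B \<inter> S) \<le> measure lebesgue ((\<Union>K\<in>F. B \<inter> K) \<union> (U - \<Union>F))"
        using U B S mBF mD by (intro measure_mono_fmeasurable fmeasurable.Un) (auto simp: fmeasurableD)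
      also have "\<dots> \<le> measure lebesgue (\<Union>K\<in>F. B \<inter> K) + measure lebesgue (U - \<Union>F)"
        using mBF mD by (intro measure_Un_le) (auto simp: fmeasurableD)
      also have "\<dots> \<le> (\<Sum>K\<in>F. measure lebesgue (B \<inter> K)) + r"
        using F mK diff by (intro add_mono measure_UNION_le) (auto simp: fmeasurableD)
      also have "\<dots> \<le> (\<Sum>K\<in>F. (\<delta> + c) * measure lebesgue K) + r"
      proof (intro add_right_mono sum_mono)
        fix K assume "K \<in> F"
        then obtain x s where "c \<le> s" "K = cube x s" using elim by blast
        then show "measure lebesgue (B \<inter> K) \<le> (\<delta> + c) * measure lebesgue K" using B(2) by blast
      qed
      also have "\<dots> = (\<delta> + c) * (\<Sum>K\<in>F. measure lebesgue K) + r"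
        by (simp add: sum_distrib_left)
      also have "\<dots> \<le> (\<delta> + c) * (measure lebesgue S + r) + r"
        using sum elim \<open>0 \<le> \<delta>\<close> by (intro add_right_mono mult_left_mono) auto
      finally show "measure lebesgue (B \<inter> S) \<le> \<delta> * measure lebesgue S + e"
        using elim by linarith
    qed
  qed
qed


section \<open>Two-sided bounds for sets of finite measure\<close>

text \<open>A lower bound is imposed on one cube only. Together with the upper bounds on all cubes
  of side at least \<open>c\<close> it yields lower bounds on subsets of that cube by passing to
  complements.\<close>

definition near_uniform :: "real \<Rightarrow> real \<Rightarrow> real \<Rightarrow> 'a::euclidean_space set \<Rightarrow> bool" where
  "near_uniform \<delta> n c B \<longleftrightarrow> cubewise_le \<delta> c B \<and>
     (\<delta> - c) * measure lebesgue (cube (0::'a) n) \<le> measure lebesgue (B \<inter> cube 0 n)"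

lemma near_uniform_imp_lebesgue: "near_uniform \<delta> n c B \<Longrightarrow> B \<in> sets lebesgue"
  by (simp add: near_uniform_def cubewise_le_def)

lemma measure_Diff_cube_tendsto_0:
  fixes S :: "'a::euclidean_space set"
  assumes "S \<in> lmeasurable"
  shows "(\<lambda>n. measure lebesgue (S - cube 0 (real n))) \<longlonglongrightarrow> 0"
proof -
  have "(\<lambda>n. measure lebesgue (S - cube 0 (real n)))
      \<longlonglongrightarrow> measure lebesgue (\<Inter>n. S - cube 0 (real n))"
  proof (rule Lim_measure_decseq)
    show "range (\<lambda>n. S - cube 0 (real n)) \<subseteq> sets lebesgue"
      using assms by (auto simp: fmeasurableD)
    show "decseq (\<lambda>n. S - cube 0 (real n))"
      unfolding decseq_def by (force simp: mem_cube)
    show "emeasure lebesgue (S - cube 0 (real n)) \<noteq> \<infinity>" for n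
      using fmeasurableD2[OF fmeasurable_Diff[OF assms sets_lebesgue_cube]] by simp
  qed
  moreover have "(\<Inter>n. S - cube 0 (real n)) = {}"
  proof -
    have "\<exists>n. x \<in> cube 0 (real n)" for x :: 'a
    proof -
      obtain n where n: "2 * norm x \<le> real n" using real_arch_simple by blast
      have "- (real n / 2) \<le> x \<bullet> i \<and> x \<bullet> i \<le> real n / 2" if "i \<in> Basis" for i
        using Basis_le_norm[OF that, of x] n by linarith
      then show ?thesis
        by (intro exI[of _ n]) (simp add: mem_cube)
    qed
    then show ?thesis by blast
  qed
  ultimately show ?thesis by (simp only: measure_empty)
qed

text \<open>Inside \<open>Q = cube 0 n\<close> the upper bound is known. The lower bound follows by
  subtracting the upper bound on \<open>Q - S\<close> from the lower bound on \<open>Q\<close>.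
  Outside \<open>Q\<close> little of \<open>S\<close> remains. The admissible \<open>c\<close>
  depend on \<open>n\<close>, hence the order of the two filters.\<close>

lemma near_uniform_measure:
  fixes S :: "'a::euclidean_space set"
  assumes S: "S \<in> lmeasurable" and "0 \<le> \<delta>" "0 < e"
  shows "\<forall>\<^sub>F n in sequentially. \<forall>\<^sub>F c in at_right 0. \<forall>B. near_uniform \<delta> (real n) c B \<longrightarrow>
           \<bar>measure lebesgue (B \<inter> S) - \<delta> * measure lebesgue S\<bar> < e"
proof -
  \<comment> \<open>The deviation will be at most \<open>2 * r\<close> upwards and
    \<open>r + \<delta> * r\<close> downwards, both below
    \<open>(3 + \<delta>) * r = e\<close>.\<close>
  define r where "r = e / (3 + \<delta>)"
  have "0 < r" using assms by (simp add: r_def)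
  have e: "2 * r + r * \<delta> < e"
  proof -
    have "(3 + \<delta>) * r = e" using assms by (simp add: r_def)
    with \<open>0 < r\<close> show ?thesis by (simp add: algebra_simps)
  qed
  have "\<forall>\<^sub>F n in sequentially. measure lebesgue (S - cube 0 (real n)) < r"
    using order_tendstoD(2)[OF measure_Diff_cube_tendsto_0[OF S] \<open>0 < r\<close>] .
  then show ?thesis
    using eventually_gt_at_top[of 0]
  proof eventually_elim
    case (elim n)
    define Q where "Q = cube (0::'a) (real n)"
    define S1 S2 T where "S1 = S \<inter> Q" and "S2 = Q - S" and "T = S - Q"
    have Q: "Q \<in> lmeasurable" by (simp add: Q_def)
    have m: "S1 \<in> lmeasurable" "S2 \<in> lmeasurable" "T \<in> lmeasurable"
      using S Q by (auto simp: S1_def S2_def T_def fmeasurableD intro: fmeasurable_Int_fmeasurable)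
    have split: "measure lebesgue (X \<union> Y) = measure lebesgue X + measure lebesgue Y"
      if "X \<in> lmeasurable" "Y \<in> lmeasurable" "X \<inter> Y = {}" for X Y :: "'a set"
      using that by (simp add: measure_Un3)
    have S_eq: "measure lebesgue S = measure lebesgue S1 + measure lebesgue T"
      using split[of S1 T] m by (simp add: S1_def T_def Int_Diff_disjoint Int_Diff_Un)
    have Q_eq: "measure lebesgue Q = measure lebesgue S1 + measure lebesgue S2"
      using split[of S1 S2] m by (simp add: S1_def S2_def Int_commute[of S] Int_Diff_disjoint Int_Diff_Un)
    have T: "measure lebesgue T < r"
      using elim by (simp add: T_def Q_def)
    have "\<forall>\<^sub>F c in at_right 0. \<forall>B. cubewise_le \<delta> c B \<longrightarrow> measure lebesgue (B \<inter> S1) \<le> \<delta> * measure lebesgue S1 + r"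
      by (rule eventually_cubewise_le_Int[of _ "real n"])
         (use m elim assms \<open>0 < r\<close> in \<open>auto simp: S1_def Q_def\<close>)
    \<comment> \<open>This bound on the complementary part \<open>S2\<close> serves the lower
      estimate; its error \<open>r/2\<close> and the loss
      \<open>c * measure lebesgue Q < r/2\<close> together cost at most \<open>r\<close>.\<close>
    moreover have "\<forall>\<^sub>F c in at_right 0. \<forall>B. cubewise_le \<delta> c B \<longrightarrow> measure lebesgue (B \<inter> S2) \<le> \<delta> * measure lebesgue S2 + r/2"
      by (rule eventually_cubewise_le_Int[of _ "real n"])
         (use m elim assms \<open>0 < r\<close> in \<open>auto simp: S2_def Q_def\<close>)
    moreover have "\<forall>\<^sub>F c in at_right 0. c * measure lebesgue Q < r/2"
    proof (rule order_tendstoD(2))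
      show "((\<lambda>c. c * measure lebesgue Q) \<longlongrightarrow> 0 * measure lebesgue Q) (at_right 0)"
        by (intro tendsto_intros)
    qed (use \<open>0 < r\<close> in simp)
    ultimately show ?case
    proof eventually_elim
      case (elim c)
      show ?case
      proof (intro allI impI)
        fix B :: "'a set" assume nu: "near_uniform \<delta> (real n) c B"
        then have sp: "cubewise_le \<delta> c B" and B: "B \<in> sets lebesgue"
          and low: "(\<delta> - c) * measure lebesgue Q \<le> measure lebesgue (B \<inter> Q)"
          by (auto simp: near_uniform_def cubewise_le_def Q_def)
        have mB: "B \<inter> X \<in> lmeasurable" if "X \<in> lmeasurable" for X
          using that B by (metis Int_commute fmeasurable_Int_fmeasurable)
        have BS: "measure lebesgue (B \<inter> S) = measure lebesgue (B \<inter> S1) + measure lebesgue (B \<inter> T)"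
        proof -
          have "B \<inter> S = (B \<inter> S1) \<union> (B \<inter> T)" "(B \<inter> S1) \<inter> (B \<inter> T) = {}"
            by (auto simp: S1_def T_def)
          then show ?thesis using split[of "B \<inter> S1" "B \<inter> T"] m mB by simp
        qed
        have BQ: "measure lebesgue (B \<inter> Q) = measure lebesgue (B \<inter> S1) + measure lebesgue (B \<inter> S2)"
        proof -
          have "B \<inter> Q = (B \<inter> S1) \<union> (B \<inter> S2)" "(B \<inter> S1) \<inter> (B \<inter> S2) = {}"
            by (auto simp: S1_def S2_def)
          then show ?thesis using split[of "B \<inter> S1" "B \<inter> S2"] m mB by simp
        qed
        have BT: "measure lebesgue (B \<inter> T) \<le> measure lebesgue T"
          using m mB by (intro measure_mono_fmeasurable) (auto simp: fmeasurableD)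
        have 1: "measure lebesgue (B \<inter> S1) \<le> \<delta> * measure lebesgue S1 + r"
          and 2: "measure lebesgue (B \<inter> S2) \<le> \<delta> * measure lebesgue S2 + r/2"
          using elim sp by blast+
        have "\<delta> * measure lebesgue T \<le> \<delta> * r"
          using T \<open>0 \<le> \<delta>\<close> by (intro mult_left_mono) auto
        moreover have "0 \<le> \<delta> * measure lebesgue T"
          using \<open>0 \<le> \<delta>\<close> by simp
        moreover have "0 \<le> measure lebesgue (B \<inter> T)" "0 \<le> \<delta> * r"
          using \<open>0 < r\<close> \<open>0 \<le> \<delta>\<close> by simp_all
        moreover have "\<delta> * measure lebesgue Q - c * measure lebesgue Q \<le> measure lebesgue (B \<inter> Q)"
          using low by (simp add: algebra_simps)
        moreover have "\<delta> * measure lebesgue Q = \<delta> * measure lebesgue S1 + \<delta> * measure lebesgue S2"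
          "\<delta> * measure lebesgue S = \<delta> * measure lebesgue S1 + \<delta> * measure lebesgue T"
          by (simp_all add: Q_eq S_eq algebra_simps)
        ultimately show "\<bar>measure lebesgue (B \<inter> S) - \<delta> * measure lebesgue S\<bar> < e"
          using e 1 2 BS BQ BT T elim(3) \<open>0 < r\<close> unfolding abs_less_iff mult.commute[of r] by linarith
      qed
    qed
  qed
qed

section \<open>Testing against integrable functions\<close>

lemma integrable_indicator_mult:
  fixes g :: "'a \<Rightarrow> real"
  assumes "integrable M g" "B \<in> sets M"
  shows "integrable M (\<lambda>x. indicator B x * g x)"
  using integrable_mult_indicator[OF assms(2,1)] by simp

lemma near_uniform_integral:
  fixes g :: "'a::euclidean_space \<Rightarrow> real"
  assumes "integrable lebesgue g" and "0 \<le> \<delta>" "0 < e"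
  shows "\<forall>\<^sub>F n in sequentially. \<forall>\<^sub>F c in at_right 0. \<forall>B. near_uniform \<delta> (real n) c B \<longrightarrow>
           \<bar>(\<integral>x. indicator B x * g x \<partial>lebesgue) - \<delta> * integral\<^sup>L lebesgue g\<bar> < e"
  using assms(1) \<open>0 < e\<close>
proof (induction arbitrary: e rule: integrable_induct)
  case (base S a)
  then have S: "S \<in> lmeasurable" by (simp add: fmeasurable_def)
  \<comment> \<open>The \<open>+ 1\<close> covers \<open>a = 0\<close> and makes the final bound
    strict after multiplying by \<open>\<bar>a\<bar>\<close>.\<close>
  have "0 < e / (\<bar>a\<bar> + 1)" using base by simp
  from near_uniform_measure[OF S \<open>0 \<le> \<delta>\<close> this]
  show ?case
  proof (elim eventually_mono, intro allI impI, elim allE impE)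
    fix n c and B :: "'a set"
    assume nu: "near_uniform \<delta> (real n) c B"
      and lt: "\<bar>measure lebesgue (B \<inter> S) - \<delta> * measure lebesgue S\<bar> < e / (\<bar>a\<bar> + 1)"
    have "B \<inter> S \<in> lmeasurable"
      using S near_uniform_imp_lebesgue[OF nu] by (metis Int_commute fmeasurable_Int_fmeasurable)
    moreover have "(\<integral>x. indicator B x * (indicator S x *\<^sub>R a) \<partial>lebesgue)
        = (\<integral>x. indicator (B \<inter> S) x * a \<partial>lebesgue)"
      by (intro Bochner_Integration.integral_cong) (auto simp: indicator_def)
    ultimately have "(\<integral>x. indicator B x * (indicator S x *\<^sub>R a) \<partial>lebesgue)
        - \<delta> * (\<integral>x. indicator S x *\<^sub>R a \<partial>lebesgue)
        = (measure lebesgue (B \<inter> S) - \<delta> * measure lebesgue S) * a"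
      using S by (simp add: algebra_simps)
    also have "\<bar>\<dots>\<bar> \<le> (e / (\<bar>a\<bar> + 1)) * \<bar>a\<bar>"
      unfolding abs_mult using lt by (intro mult_right_mono) auto
    also have "\<dots> < e" using base by (simp add: field_simps)
    finally show "\<bar>(\<integral>x. indicator B x * (indicator S x *\<^sub>R a) \<partial>lebesgue)
        - \<delta> * (\<integral>x. indicator S x *\<^sub>R a \<partial>lebesgue)\<bar> < e" .
  qed
next
  case (add f g)
  have "0 < e/2" using add.prems by simp
  from add.IH(1)[OF this] add.IH(2)[OF this] show ?case
  proof eventually_elim
    case (elim n)
    then show ?case
    proof eventually_elim
      case (elim c)
      show ?case
      proof (intro allI impI)
        fix B :: "'a set" assume nu: "near_uniform \<delta> (real n) c B"
        have "(\<integral>x. indicator B x * (f x + g x) \<partial>lebesgue) =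
            (\<integral>x. indicator B x * f x \<partial>lebesgue) + (\<integral>x. indicator B x * g x \<partial>lebesgue)"
          using add.hyps near_uniform_imp_lebesgue[OF nu]
          by (simp add: integrable_indicator_mult distrib_left)
        moreover have "\<delta> * (\<integral>x. f x + g x \<partial>lebesgue) = \<delta> * integral\<^sup>L lebesgue f + \<delta> * integral\<^sup>L lebesgue g"
          using add.hyps by (simp add: distrib_left)
        ultimately show "\<bar>(\<integral>x. indicator B x * (f x + g x) \<partial>lebesgue) - \<delta> * (\<integral>x. f x + g x \<partial>lebesgue)\<bar> < e"
          using elim[THEN spec, THEN mp, OF nu] by linarith
      qed
    qed
  qed
next
  case (lim f s)
  \<comment> \<open>The induction rule supplies approximants with
    \<open>\<bar>s i x\<bar> \<le> 2 * \<bar>f x\<bar>\<close>, whence the dominating function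
    \<open>3 * \<bar>f x\<bar>\<close>.\<close>
  have "(\<lambda>i. \<integral>x. \<bar>s i x - f x\<bar> \<partial>lebesgue) \<longlonglongrightarrow> (\<integral>x. 0 \<partial>(lebesgue :: 'a measure))"
  proof (rule integral_dominated_convergence)
    show "integrable lebesgue (\<lambda>x. 3 * \<bar>f x\<bar>)" using lim.hyps by simp
    show "AE x in lebesgue. (\<lambda>i. \<bar>s i x - f x\<bar>) \<longlonglongrightarrow> 0"
      using lim.hyps(2) by (intro AE_I2 tendsto_rabs_zero) (simp add: LIM_zero)
    have "\<bar>s i x - f x\<bar> \<le> 3 * \<bar>f x\<bar>" for i x
      using lim.hyps(3)[of x i] by simp
    then show "AE x in lebesgue. norm \<bar>s i x - f x\<bar> \<le> 3 * \<bar>f x\<bar>" for i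
      by simp
  qed (use lim.hyps in auto)
  \<comment> \<open>Replacing \<open>f\<close> by \<open>s i\<close> changes the integral over
    \<open>B\<close> by at most the \<open>L^1\<close> distance, and the term with
    \<open>\<delta>\<close> by at most \<open>\<delta>\<close> times it.\<close>
  then have "(\<lambda>i. (1 + \<delta>) * (\<integral>x. \<bar>s i x - f x\<bar> \<partial>lebesgue)) \<longlonglongrightarrow> (1 + \<delta>) * 0"
    by (intro tendsto_intros) simp
  then have "\<forall>\<^sub>F i in sequentially. (1 + \<delta>) * (\<integral>x. \<bar>s i x - f x\<bar> \<partial>lebesgue) < e/2"
    using lim.prems by (intro order_tendstoD(2)) auto
  then obtain i where i: "(1 + \<delta>) * (\<integral>x. \<bar>s i x - f x\<bar> \<partial>lebesgue) < e/2"
    using eventually_happens by force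
  have diff: "integrable lebesgue (\<lambda>x. s i x - f x)" using lim.hyps by simp
  have "0 < e/2" using lim.prems by simp
  from lim.IH[OF this, of i] show ?case
  proof (elim eventually_mono, intro allI impI, elim allE impE)
    fix n c and B :: "'a set"
    assume nu: "near_uniform \<delta> (real n) c B"
      and lt: "\<bar>(\<integral>x. indicator B x * s i x \<partial>lebesgue) - \<delta> * integral\<^sup>L lebesgue (s i)\<bar> < e/2"
    note B = near_uniform_imp_lebesgue[OF nu]
    let ?I = "\<integral>x. \<bar>s i x - f x\<bar> \<partial>lebesgue"
    have "(\<integral>x. indicator B x * s i x \<partial>lebesgue) - (\<integral>x. indicator B x * f x \<partial>lebesgue)
        = (\<integral>x. indicator B x * (s i x - f x) \<partial>lebesgue)"
      using lim.hyps B by (simp add: integrable_indicator_mult right_diff_distrib)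
    moreover have "\<bar>\<integral>x. indicator B x * (s i x - f x) \<partial>lebesgue\<bar> \<le> ?I"
      using integrable_indicator_mult[OF diff B] diff
      by (intro order_trans[OF integral_abs_bound] integral_mono) (auto simp: indicator_def)
    moreover have "\<bar>\<delta> * integral\<^sup>L lebesgue (s i) - \<delta> * integral\<^sup>L lebesgue f\<bar> \<le> \<delta> * ?I"
    proof -
      have "\<delta> * integral\<^sup>L lebesgue (s i) - \<delta> * integral\<^sup>L lebesgue f = \<delta> * (\<integral>x. s i x - f x \<partial>lebesgue)"
        using lim.hyps by (simp add: right_diff_distrib)
      then show ?thesis
        using \<open>0 \<le> \<delta>\<close> integral_abs_bound[of lebesgue "\<lambda>x. s i x - f x"]
        by (simp add: abs_mult mult_left_mono)
    qed
    moreover have "?I + \<delta> * ?I < e/2" using i by (simp add: distrib_right)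
    ultimately show "\<bar>(\<integral>x. indicator B x * f x \<partial>lebesgue) - \<delta> * integral\<^sup>L lebesgue f\<bar> < e"
      using lt by linarith
  qed
qed

section \<open>Rescaling the set into the weak-* neighbourhood\<close>

theorem theorem1p5:
  fixes P :: "'a::euclidean_space set \<Rightarrow> bool" and A :: "'a set" and \<delta> :: real
  assumes "0 < \<delta>" "\<delta> \<le> 1"
    and "mild \<delta> P"
    and "A \<in> sets lebesgue"
    and "upper_banach_density A = ereal \<delta>"
  shows "\<exists>t0>0. \<forall>t\<ge>t0. P ((\<lambda>a. inverse t *\<^sub>R a) ` A)"
proof -
  obtain U where U: "weakstar_open_Sd U" "(\<lambda>_. \<delta>) \<in> U"
      "\<And>B. B \<in> sets lebesgue \<Longrightarrow> (indicator B :: 'a \<Rightarrow> real) \<in> U \<Longrightarrow> P B"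
    using assms(3) unfolding mild_def by blast
  have trans: "P B = P ((\<lambda>a. v + a) ` B)" if "B \<in> sets lebesgue" for B v
    using assms(3) that unfolding mild_def by blast
  from U(1)[unfolded weakstar_open_Sd_def, THEN conjunct2, THEN bspec, OF U(2)]
  obtain G e where G: "finite G" "\<forall>g\<in>G. integrable lebesgue g" "0 < e"
    and nbhd: "\<forall>h\<in>Sd. (\<forall>g\<in>G. \<bar>\<integral>x. (h x - \<delta>) * g x \<partial>lebesgue\<bar> < e) \<longrightarrow> h \<in> U"
    by (elim exE conjE)
  define close where "close n c g \<longleftrightarrow> (\<forall>B. near_uniform \<delta> (real n) c B \<longrightarrow>
      \<bar>(\<integral>x. indicator B x * g x \<partial>lebesgue) - \<delta> * integral\<^sup>L lebesgue g\<bar> < e)"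
    for n :: nat and c and g :: "'a \<Rightarrow> real"
  have "\<forall>\<^sub>F n in sequentially. \<forall>\<^sub>F c in at_right 0. close n c g" if "g \<in> G" for g
    unfolding close_def using bspec[OF G(2) that] less_imp_le[OF assms(1)] G(3)
    by (rule near_uniform_integral)
  \<comment> \<open>Since \<open>G\<close> is finite, one \<open>n\<close>, and then one
    \<open>c\<close>, can serve all test functions.\<close>
  then have "\<forall>\<^sub>F n in sequentially. \<forall>g\<in>G. \<forall>\<^sub>F c in at_right 0. close n c g"
    by (simp add: eventually_ball_finite_distrib[OF G(1)])
  then have "\<forall>\<^sub>F n in sequentially. 0 < n \<and> (\<forall>g\<in>G. \<forall>\<^sub>F c in at_right 0. close n c g)"
    using eventually_gt_at_top[of 0] by eventually_elim simp
  from eventually_happens'[OF trivial_limit_sequentially this]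
  obtain n where "0 < n" and n: "\<forall>g\<in>G. \<forall>\<^sub>F c in at_right 0. close n c g"
    by blast
  have "\<forall>\<^sub>F c in at_right 0. 0 < c \<and> (\<forall>g\<in>G. close n c g)"
    using n by (simp add: eventually_conj_iff eventually_at_right_less eventually_ball_finite_distrib[OF G(1)])
  from eventually_happens'[OF trivial_limit_at_right_real this]
  obtain c where "0 < c" and c: "\<forall>g\<in>G. close n c g"
    by blast
  have PB: "P B" if nu: "near_uniform \<delta> (real n) c B" for B
  proof (intro U(3) nbhd[THEN bspec, THEN mp] ballI)
    show B: "B \<in> sets lebesgue" by (rule near_uniform_imp_lebesgue[OF nu])
    then show "indicator B \<in> Sd"
      by (auto simp: Sd_def indicator_def)
    fix g assume g: "g \<in> G"
    have "(\<integral>x. (indicator B x - \<delta>) * g x \<partial>lebesgue)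
        = (\<integral>x. indicator B x * g x \<partial>lebesgue) - \<delta> * integral\<^sup>L lebesgue g"
      using bspec[OF G(2) g] B by (simp add: integrable_indicator_mult left_diff_distrib)
    then show "\<bar>\<integral>x. (indicator B x - \<delta>) * g x \<partial>lebesgue\<bar> < e"
      using c[THEN bspec, OF g, unfolded close_def, THEN spec, THEN mp, OF nu] by simp
  qed
  obtain t1 where "0 < t1" and t1: "\<And>s x. t1 \<le> s \<Longrightarrow>
      measure lebesgue (A \<inter> cube x s) \<le> (\<delta> + c) * measure lebesgue (cube x s)"
    using eventually_density_le[OF assms(4), of "\<delta> + c"] assms(5) \<open>0 < c\<close> by auto
  \<comment> \<open>A cube of side \<open>s \<ge> c\<close> after rescaling comes from one of side
    \<open>t * s \<ge> t * c \<ge> t1\<close>, where the upper density bound holds.\<close>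
  have "P ((\<lambda>a. inverse t *\<^sub>R a) ` A)" if "t1 / c \<le> t" for t
  proof -
    have "0 < t1 / c" using \<open>0 < t1\<close> \<open>0 < c\<close> by simp
    then have "0 < t" using that by linarith
    obtain x where x: "(\<delta> - c) * measure lebesgue (cube x (t * n)) \<le> measure lebesgue (A \<inter> cube x (t * n))"
      using exists_dense_cube[OF assms(4), of "t * n" "\<delta> - c"] assms(5) \<open>0 < c\<close> \<open>0 < t\<close> \<open>0 < n\<close> by auto
    \<comment> \<open>This translation moves the rescaled dense cube, of side \<open>n\<close>, to
      the origin; translation invariance of \<open>P\<close> undoes it at the end.\<close>
    define v where "v = - (inverse t *\<^sub>R x)"
    define B where "B = (\<lambda>a. v + a) ` (\<lambda>a. inverse t *\<^sub>R a) ` A"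
    have B: "measure lebesgue (B \<inter> cube y s) = measure lebesgue (A \<inter> cube (t *\<^sub>R (y - v)) (t * s)) / t ^ DIM('a)"
      for y s
      unfolding B_def by (rule measure_affine_image_Int_cube[OF \<open>0 < t\<close>])
    have scale: "measure lebesgue (cube z (t * s)) = measure lebesgue (cube y s) * t ^ DIM('a)"
      if "0 \<le> s" for s and y z :: 'a
      using that \<open>0 < t\<close> by (simp add: measure_cube power_mult_distrib)
    have "near_uniform \<delta> (real n) c B"
      unfolding near_uniform_def cubewise_le_def
    proof (intro conjI allI impI)
      show "B \<in> sets lebesgue"
        unfolding B_def using assms(4) by (rule affine_image_lebesgue)
      show "measure lebesgue (B \<inter> cube y s) \<le> (\<delta> + c) * measure lebesgue (cube y s)"
        if "c \<le> s" for y s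
      proof -
        have "t1 \<le> t * c" using \<open>t1 / c \<le> t\<close> \<open>0 < c\<close> by (simp add: field_simps)
        also have "\<dots> \<le> t * s" using that \<open>0 < t\<close> by simp
        finally show ?thesis
          using t1[of "t * s" "t *\<^sub>R (y - v)"] scale[of s _ y] that \<open>0 < c\<close> \<open>0 < t\<close>
          by (simp add: B pos_divide_le_eq mult.assoc)
      qed
      have "t *\<^sub>R (0 - v) = x" using \<open>0 < t\<close> by (simp add: v_def)
      then show "(\<delta> - c) * measure lebesgue (cube (0::'a) (real n)) \<le> measure lebesgue (B \<inter> cube 0 (real n))"
        using x scale[of "real n" x 0] \<open>0 < t\<close>
        by (simp add: B pos_le_divide_eq mult.assoc)
    qed
    then have "P B" by (rule PB)
    moreover have "(\<lambda>a. inverse t *\<^sub>R a) ` A \<in> sets lebesgue"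
      using affine_image_lebesgue[OF assms(4), of 0 "inverse t"] by simp
    ultimately show ?thesis
      using trans unfolding B_def by blast
  qed
  then show ?thesis
    using \<open>0 < t1\<close> \<open>0 < c\<close> by (intro exI[of _ "t1 / c"]) auto
qed

end
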